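(* If a polytope $P\subset\mathbb{R}^n$ has depth complexity $d<\lceil\log_2(n+1)\rceil$, then $$\rho_\Delta(P)\le 2^d-1,$$ where $\Delta=\Delta^n$ is the standard regular $n$-simplex. This bound is sharp (this inequality is an equality for some polytopes).
   Context: $\Delta=\Delta^n\subset\mathbb{R}^n$ is the regular simplex obtained by orthogonally projecting $\mathsf{conv}\{e_1,\dots,e_{n+1}\}\subset\mathbb{R}^{n+1}$ to the hyperplane orthogonal to $(1,\dots,1)$ (identified isometrically with $\mathbb{R}^n$), where $e_1,\dots,e_{n+1}$ are the standard unit vectors and $\mathsf{conv}$ denotes convex hull. For compact convex $K,L\subset\mathbb{R}^n$, $\lambda_K(L):=\inf\{\lambda\ge 0:\exists x\in\mathbb{R}^n,\ L\subset x+\lambda K\}$. For a compact convex $L$ that is not a point, $\rho_\Delta(L):=\lambda_{-\Delta}(L)/\lambda_\Delta(L)$; if $L$ is a point, $\rho_\Delta(L):=0$. Define $\mathcal{P}_{n,0}=\{\{x\}:x\in\mathbb{R}^n\}$ and, for $d>0$, $$\mathcal{P}_{n,d}=\Big\{\sum_{j=1}^m\mathsf{conv}(K_j\cup L_j):m\in\mathbb{N},\ K_j,L_j\in\mathcal{P}_{n,d-1}\Big\}$$ (Minkowski sum, $m\ge 1$). The depth complexity of a polytope $P\subset\mathbb{R}^n$ is the smallest $d$ with $P\in\mathcal{P}_{n,d}$. *)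

theory Defs
  imports "HOL-Analysis.Analysis"
begin

text \<open>
  The space of dimension \<open>n\<close> is \<open>real^'n\<close> with \<open>n = CARD('n)\<close>; since
  \<open>CARD('n option) = n + 1\<close>, the ambient space of the standard unit vectors
  \<open>e\<^sub>1, \<dots>, e\<^sub>n\<^sub>+\<^sub>1\<close> is \<open>real^('n option)\<close>.  In \<open>real^'m\<close> the numeral \<open>1\<close> is the
  all-ones vector.
\<close>

definition ones_hyperplane :: "(real^'m) set" where
  "ones_hyperplane = {x. x \<bullet> 1 = 0}"

definition proj_ones :: "real^'m \<Rightarrow> real^'m" where
  "proj_ones x = x - ((x \<bullet> 1) / (1 \<bullet> (1::real^'m))) *\<^sub>R 1"

text \<open>
  Only the values of \<open>\<phi>\<close> on the hyperplane matter; linearity on the whole ambient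
  space is no restriction, because a linear map on a subspace extends.
\<close>

definition hyperplane_isometry :: "(real^('n option) \<Rightarrow> real^'n) \<Rightarrow> bool" where
  "hyperplane_isometry \<phi> \<longleftrightarrow>
     linear \<phi> \<and> \<phi> ` ones_hyperplane = UNIV \<and> (\<forall>x\<in>ones_hyperplane. norm (\<phi> x) = norm x)"

definition regular_simplex :: "(real^('n option) \<Rightarrow> real^'n) \<Rightarrow> (real^'n) set" where
  "regular_simplex \<phi> = \<phi> ` proj_ones ` (convex hull (range (\<lambda>i. axis i 1)))"

text \<open>
  The infimum is taken in \<open>real\<close>, so it is meaningful only when some translate of some
  \<open>\<lambda>K\<close> contains \<open>L\<close>.  This is always so for bounded \<open>L\<close> when \<open>K\<close> has nonempty interior,
  as for \<open>\<Delta>\<close> and \<open>-\<Delta>\<close>.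
\<close>

definition circum_scale :: "'a::real_vector set \<Rightarrow> 'a set \<Rightarrow> real" where
  "circum_scale K L = Inf {l. 0 \<le> l \<and> (\<exists>x. L \<subseteq> (\<lambda>k. x + l *\<^sub>R k) ` K)}"

definition rho :: "'a::real_vector set \<Rightarrow> 'a set \<Rightarrow> real" where
  "rho D L = (if \<exists>x. L = {x} then 0 else circum_scale (uminus ` D) L / circum_scale D L)"

text \<open>
  The sum below is the Minkowski sum, from \<^theory>\<open>HOL-Library.Set_Algebras\<close>.
\<close>

primrec depth_class :: "nat \<Rightarrow> 'a::real_vector set set" where
  "depth_class 0 = {{x} |x. True}"
| "depth_class (Suc d) =
     {\<Sum>j=1..m. convex hull (K j \<union> L j) |(m::nat) K L.
        1 \<le> m \<and> (\<forall>j\<in>{1..m}. K j \<in> depth_class d \<and> L j \<in> depth_class d)}"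

definition has_depth_complexity :: "'a::real_vector set \<Rightarrow> nat \<Rightarrow> bool" where
  "has_depth_complexity P d \<longleftrightarrow> P \<in> depth_class d \<and> (\<forall>e<d. P \<notin> depth_class e)"

lemma hyperplane_isometry_exists:
  "\<exists>\<phi> :: real^('n::finite option) \<Rightarrow> real^'n. hyperplane_isometry \<phi>"
proof -
  let ?H = "ones_hyperplane :: (real^('n option)) set"
  have H: "?H = {x. 1 \<bullet> x = 0}"
    by (simp add: ones_hyperplane_def inner_commute)
  have "(1 :: real^('n option)) \<noteq> 0"
    by simp
  then have "dim ?H = DIM(real^('n option)) - 1"
    unfolding H by (rule dim_hyperplane)
  then have "dim ?H = dim (UNIV :: (real^'n) set)"
    by simp
  then obtain f :: "real^('n option) \<Rightarrow> real^'n"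
    where "linear f" "f ` ?H = UNIV" "\<And>x. x \<in> ?H \<Longrightarrow> norm (f x) = norm x"
    using isometries_subspaces[of ?H "UNIV :: (real^'n) set"]
    by (metis H subspace_UNIV subspace_hyperplane)
  then show ?thesis
    unfolding hyperplane_isometry_def by blast
qed

end

theory Submission
  imports Defs
begin

text \<open>
  For a regular simplex \<open>\<Delta>\<close> with vertices \<open>w\<^sub>i\<close> and centroid \<open>0\<close>, the facet opposite to \<open>w\<^sub>i\<close>
  has outer normal \<open>-w\<^sub>i\<close>.  A translate of \<open>\<lambda>\<Delta>\<close> contains \<open>L\<close> exactly if some vector \<open>x\<close>
  solves one inequality per facet between \<open>h\<^sub>L(-w\<^sub>i)\<close>, the support function of \<open>L\<close>, and
  \<open>-w\<^sub>i \<bullet> x\<close> plus a multiple of \<open>\<lambda>\<close>.  The numbers \<open>w\<^sub>i \<bullet> x\<close> can be prescribed arbitrarily subject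
  only to their sum being zero, so the system is solvable exactly if its sum is consistent.  Hence
  both scales are sums of support values (\<open>circum_scale_simplex\<close>, \<open>rho_simplex\<close>):
  \<open>\<lambda>\<^sub>\<Delta>(L) = \<Sum>\<^sub>i h\<^sub>L(-w\<^sub>i)\<close> and \<open>\<lambda>\<^sub>-\<^sub>\<Delta>(L) = \<Sum>\<^sub>i h\<^sub>L(w\<^sub>i)\<close>.  In particular they are additive under
  Minkowski sums, monotone and translation invariant.

  The upper bound is an induction on the depth.  By additivity only \<open>M = conv(K \<union> L)\<close> matters.
  Choosing \<open>k \<in> K\<close> and \<open>l \<in> L\<close> gives \<open>M \<subseteq> (K - k) + (L - l) + conv{k, l}\<close>.  A segment has
  the same two scales, being a translate of its reflection, and the segment lies in \<open>M\<close>, so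
  \<open>\<lambda>\<^sub>-\<^sub>\<Delta>(M) \<le> \<lambda>\<^sub>-\<^sub>\<Delta>(K) + \<lambda>\<^sub>-\<^sub>\<Delta>(L) + \<lambda>\<^sub>\<Delta>(M)\<close> (\<open>sum_support_hull_le\<close>).  Monotonicity of
  \<open>\<lambda>\<^sub>\<Delta>\<close> then turns a bound \<open>c\<close> on the ratios of \<open>K\<close> and \<open>L\<close> into the bound \<open>2c + 1\<close> for \<open>M\<close>,
  and \<open>2\<^sup>d - 1\<close> is the solution of this recursion that starts at \<open>0\<close>.

  Equality holds for a face of \<open>\<Delta>\<close> with \<open>2\<^sup>d\<close> vertices, which exists because
  \<open>2\<^sup>d < n + 1\<close>.  Halving its vertex set repeatedly shows that it has depth at most \<open>d\<close>
  (\<open>convex_hull_power_two_depth_class\<close>).  A face with \<open>k \<ge> 2\<close> vertices has ratio \<open>k - 1\<close>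
  (\<open>rho_face\<close>), and the upper bound itself excludes a smaller depth.
\<close>

section \<open>Support functions\<close>

definition support_fun :: "'a::real_inner set \<Rightarrow> 'a \<Rightarrow> real" where
  "support_fun L u = (SUP x\<in>L. u \<bullet> x)"

lemma bdd_above_inner_image:
  fixes L :: "'a::real_inner set"
  assumes "bounded L"
  shows "bdd_above ((\<bullet>) u ` L)"
  using assms
  by (intro bounded_imp_bdd_above bounded_linear_image bounded_linear_inner_right)

lemma support_fun_upper:
  fixes L :: "'a::real_inner set"
  assumes "bounded L" "x \<in> L"
  shows "u \<bullet> x \<le> support_fun L u"
  unfolding support_fun_def using assms by (intro cSUP_upper bdd_above_inner_image)

lemma support_fun_least:
  fixes L :: "'a::real_inner set"
  assumes "L \<noteq> {}" "\<And>x. x \<in> L \<Longrightarrow> u \<bullet> x \<le> c"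
  shows "support_fun L u \<le> c"
  unfolding support_fun_def using assms by (intro cSUP_least)

lemma support_fun_mono:
  fixes K L :: "'a::real_inner set"
  assumes "bounded L" "K \<noteq> {}" "K \<subseteq> L"
  shows "support_fun K u \<le> support_fun L u"
  using assms by (intro support_fun_least) (auto intro: support_fun_upper)

lemma support_fun_convex_hull_least:
  fixes S :: "'a::real_inner set"
  assumes "S \<noteq> {}" "\<And>x. x \<in> S \<Longrightarrow> u \<bullet> x \<le> c"
  shows "support_fun (convex hull S) u \<le> c"
proof (rule support_fun_least)
  show "convex hull S \<noteq> {}" using assms(1) by simp
  have "convex hull S \<subseteq> {x. u \<bullet> x \<le> c}"
    using assms(2) by (intro hull_minimal convex_halfspace_le) auto
  then show "u \<bullet> x \<le> c" if "x \<in> convex hull S" for x using that by auto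
qed

lemma support_fun_singleton [simp]: "support_fun {x} u = u \<bullet> x"
  by (simp add: support_fun_def)

lemma support_fun_uminus_image: "support_fun (uminus ` L) u = support_fun L (- u)"
  by (simp add: support_fun_def image_image)

lemma bounded_set_plus:
  fixes A B :: "'a::real_normed_vector set"
  assumes "bounded A" "bounded B"
  shows "bounded (A + B)"
proof -
  have "A + B = (\<Union>x\<in>A. \<Union>y\<in>B. {x + y})"
    by (auto simp: set_plus_def)
  then show ?thesis using bounded_sums[OF assms] by simp
qed

lemma support_fun_plus:
  fixes A B :: "'a::real_inner set"
  assumes A: "bounded A" "A \<noteq> {}" and B: "bounded B" "B \<noteq> {}"
  shows "support_fun (A + B) u = support_fun A u + support_fun B u"
proof (rule antisym)
  show "support_fun (A + B) u \<le> support_fun A u + support_fun B u"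
  proof (rule support_fun_least)
    show "A + B \<noteq> {}" using A B by (auto simp: set_plus_def)
  next
    fix x assume "x \<in> A + B"
    then show "u \<bullet> x \<le> support_fun A u + support_fun B u"
      using A B by (auto elim!: set_plus_elim simp: inner_add_right
          intro!: add_mono support_fun_upper)
  qed
  have "support_fun A u \<le> support_fun (A + B) u - support_fun B u"
  proof (rule support_fun_least[OF A(2)])
    fix x assume x: "x \<in> A"
    have "support_fun B u \<le> support_fun (A + B) u - u \<bullet> x"
    proof (rule support_fun_least[OF B(2)])
      fix y assume "y \<in> B"
      with x have "x + y \<in> A + B" by (rule set_plus_intro)
      from support_fun_upper[OF bounded_set_plus[OF A(1) B(1)] this]
      show "u \<bullet> y \<le> support_fun (A + B) u - u \<bullet> x"
        by (simp add: inner_add_right algebra_simps)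
    qed
    then show "u \<bullet> x \<le> support_fun (A + B) u - support_fun B u" by simp
  qed
  then show "support_fun A u + support_fun B u \<le> support_fun (A + B) u" by simp
qed

lemma bounded_nonempty_set_sum:
  fixes A :: "'i \<Rightarrow> 'a::real_normed_vector set"
  assumes "finite J" "\<And>j. j \<in> J \<Longrightarrow> bounded (A j) \<and> A j \<noteq> {}"
  shows "bounded (\<Sum>j\<in>J. A j) \<and> (\<Sum>j\<in>J. A j) \<noteq> {}"
  using assms
proof (induction J rule: finite_induct)
  case (insert j J)
  moreover have "X + Y \<noteq> {}" if "X \<noteq> {}" "Y \<noteq> {}" for X Y :: "'a set"
    using that by (auto simp: set_plus_def)
  ultimately show ?case by (auto intro!: bounded_set_plus)
qed (simp add: set_zero)

lemma support_fun_sum: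
  fixes A :: "'i \<Rightarrow> 'a::real_inner set"
  assumes "finite J" "\<And>j. j \<in> J \<Longrightarrow> bounded (A j) \<and> A j \<noteq> {}"
  shows "support_fun (\<Sum>j\<in>J. A j) u = (\<Sum>j\<in>J. support_fun (A j) u)"
  using assms
proof (induction J rule: finite_induct)
  case (insert j J)
  then show ?case
    using bounded_nonempty_set_sum[of J A] by (simp add: support_fun_plus)
qed (simp add: set_zero)

section \<open>The depth bound for balanced families of directions\<close>

lemma depth_class_bounded_nonempty:
  fixes P :: "'a::real_normed_vector set"
  assumes "P \<in> depth_class d"
  shows "bounded P \<and> P \<noteq> {}"
  using assms
proof (induction d arbitrary: P)
  case (Suc d)
  then obtain m K L where P: "P = (\<Sum>j=1..m::nat. convex hull (K j \<union> L j))"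
    and KL: "\<forall>j\<in>{1..m}. K j \<in> depth_class d \<and> L j \<in> depth_class d" by auto
  show ?case unfolding P
  proof (rule bounded_nonempty_set_sum)
    fix j assume "j \<in> {1..m}"
    with KL Suc.IH have "bounded (K j) \<and> K j \<noteq> {}" "bounded (L j) \<and> L j \<noteq> {}" by blast+
    then show "bounded (convex hull (K j \<union> L j)) \<and> convex hull (K j \<union> L j) \<noteq> {}"
      by (simp add: bounded_convex_hull)
  qed simp
qed auto

text \<open>
  This is the inclusion \<open>M \<subseteq> (K - k) + (L - l) + conv{k, l}\<close> for the hull \<open>M\<close> of \<open>K \<union> L\<close>, read
  off direction by direction.  Balancedness removes the translations by \<open>k\<close> and \<open>l\<close> from the sums
  and makes the segment contribute equally to \<open>a\<close> and \<open>-a\<close>.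
\<close>

lemma sum_support_hull_le:
  fixes K L :: "'a::real_inner set" and a :: "'i \<Rightarrow> 'a"
  assumes K: "bounded K" "K \<noteq> {}" and L: "bounded L" "L \<noteq> {}"
    and balanced: "(\<Sum>i\<in>I. a i) = 0"
  shows "(\<Sum>i\<in>I. support_fun (convex hull (K \<union> L)) (- a i)) \<le>
    (\<Sum>i\<in>I. support_fun K (- a i)) + (\<Sum>i\<in>I. support_fun L (- a i))
      + (\<Sum>i\<in>I. support_fun (convex hull (K \<union> L)) (a i))"
proof -
  let ?M = "convex hull (K \<union> L)"
  obtain k l where k: "k \<in> K" and l: "l \<in> L" using K L by auto
  have M: "bounded ?M" using K L by (simp add: bounded_convex_hull)
  have kM: "k \<in> ?M" and lM: "l \<in> ?M" using k l by (auto intro: hull_inc)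
  have zero: "(\<Sum>i\<in>I. a i \<bullet> x) = 0" for x
    using balanced by (simp flip: inner_sum_left)
  \<comment> \<open>Here \<open>a i \<bullet> k + a i \<bullet> l\<close> has already been added to the support value
    \<open>max (- a i \<bullet> k) (- a i \<bullet> l)\<close> of the segment, which turns it into
    \<open>max (a i \<bullet> l) (a i \<bullet> k)\<close>.\<close>
  have *: "support_fun ?M (- a i) \<le>
      support_fun K (- a i) + support_fun L (- a i) + max (a i \<bullet> k) (a i \<bullet> l)" for i
  proof (rule support_fun_convex_hull_least)
    fix x assume x: "x \<in> K \<union> L"
    have "- a i \<bullet> k \<le> support_fun K (- a i)" "- a i \<bullet> l \<le> support_fun L (- a i)"
      using K L k l by (auto intro: support_fun_upper simp del: inner_minus_left)
    moreover have "- a i \<bullet> x \<le> support_fun K (- a i) \<or> - a i \<bullet> x \<le> support_fun L (- a i)"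
      using K L x by (auto intro: support_fun_upper simp del: inner_minus_left)
    ultimately show "- a i \<bullet> x \<le>
      support_fun K (- a i) + support_fun L (- a i) + max (a i \<bullet> k) (a i \<bullet> l)"
      by auto
  qed (use K in auto)
  have "max (a i \<bullet> k) (a i \<bullet> l) \<le> support_fun ?M (a i)" for i
    using support_fun_upper[OF M kM] support_fun_upper[OF M lM] by simp
  with * have "support_fun ?M (- a i) \<le>
      support_fun K (- a i) + support_fun L (- a i) + support_fun ?M (a i)" for i
    by (meson add_left_mono order_trans)
  then show ?thesis
    by (simp add: sum_mono flip: sum.distrib)
qed

text \<open>
  Both sides are additive in \<open>P\<close>, so one convex hull of a union is enough; there the constants
  satisfy \<open>2 * (2 ^ d - 1) + 1 = 2 ^ Suc d - 1\<close>.
\<close>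

lemma depth_class_sum_support_le:
  fixes P :: "'a::real_inner set" and a :: "'i \<Rightarrow> 'a"
  assumes "P \<in> depth_class d" and balanced: "(\<Sum>i\<in>I. a i) = 0"
  shows "(\<Sum>i\<in>I. support_fun P (- a i)) \<le> (2 ^ d - 1) * (\<Sum>i\<in>I. support_fun P (a i))"
  using assms(1)
proof (induction d arbitrary: P)
  case 0
  then obtain x where "P = {x}" by auto
  moreover have "(\<Sum>i\<in>I. a i \<bullet> x) = 0"
    using balanced by (simp flip: inner_sum_left)
  ultimately show ?case by (simp add: sum_negf)
next
  case (Suc d)
  then obtain m K L where P: "P = (\<Sum>j=1..m::nat. convex hull (K j \<union> L j))"
    and KL: "\<And>j. j \<in> {1..m} \<Longrightarrow> K j \<in> depth_class d \<and> L j \<in> depth_class d" by auto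
  let ?M = "\<lambda>j. convex hull (K j \<union> L j)"
  have K: "bounded (K j)" "K j \<noteq> {}" and L: "bounded (L j)" "L j \<noteq> {}"
    if "j \<in> {1..m}" for j
    using KL[OF that] depth_class_bounded_nonempty by blast+
  have M: "bounded (?M j) \<and> ?M j \<noteq> {}" if "j \<in> {1..m}" for j
    using K[OF that] L[OF that] by (simp add: bounded_convex_hull)
  have step: "(\<Sum>i\<in>I. support_fun (?M j) (- a i))
      \<le> (2 ^ Suc d - 1) * (\<Sum>i\<in>I. support_fun (?M j) (a i))" if j: "j \<in> {1..m}" for j
  proof -
    have c: "0 \<le> (2::real) ^ d - 1" by simp
    have sub: "K j \<subseteq> ?M j" "L j \<subseteq> ?M j" by (auto intro: hull_inc)
    have "(\<Sum>i\<in>I. support_fun (K j) (- a i)) \<le> (2 ^ d - 1) * (\<Sum>i\<in>I. support_fun (K j) (a i))"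
      using Suc.IH KL[OF j] by blast
    also have "\<dots> \<le> (2 ^ d - 1) * (\<Sum>i\<in>I. support_fun (?M j) (a i))"
      using M[OF j] K[OF j] sub c by (intro mult_left_mono sum_mono support_fun_mono) auto
    finally have 1: "(\<Sum>i\<in>I. support_fun (K j) (- a i)) \<le> \<dots>" .
    have "(\<Sum>i\<in>I. support_fun (L j) (- a i)) \<le> (2 ^ d - 1) * (\<Sum>i\<in>I. support_fun (L j) (a i))"
      using Suc.IH KL[OF j] by blast
    also have "\<dots> \<le> (2 ^ d - 1) * (\<Sum>i\<in>I. support_fun (?M j) (a i))"
      using M[OF j] L[OF j] sub c by (intro mult_left_mono sum_mono support_fun_mono) auto
    finally have 2: "(\<Sum>i\<in>I. support_fun (L j) (- a i)) \<le> \<dots>" .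
    show ?thesis
      using sum_support_hull_le[OF K[OF j] L[OF j] balanced] 1 2 by (simp add: algebra_simps)
  qed
  have decomp: "(\<Sum>i\<in>I. support_fun P (b i)) = (\<Sum>j=1..m. \<Sum>i\<in>I. support_fun (?M j) (b i))"
    for b :: "'i \<Rightarrow> 'a"
  proof -
    have "support_fun P u = (\<Sum>j=1..m. support_fun (?M j) u)" for u
      unfolding P by (rule support_fun_sum) (use M in auto)
    then show ?thesis by (simp only: sum.swap[of _ I])
  qed
  show ?case
    unfolding decomp sum_distrib_left[of _ _ "{1..m}"] by (rule sum_mono) (rule step)
qed

section \<open>Circumscribed simplices\<close>

text \<open>
  Reflecting the body instead of the simplex reduces \<open>-\<Delta>\<close> to \<open>\<Delta>\<close>.
\<close>

lemma circum_scale_uminus: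
  "circum_scale (uminus ` K) L = circum_scale K (uminus ` L)"
proof -
  have "(\<exists>x. L \<subseteq> (\<lambda>k. x + r *\<^sub>R k) ` uminus ` K) \<longleftrightarrow>
        (\<exists>x. uminus ` L \<subseteq> (\<lambda>k. x + r *\<^sub>R k) ` K)" (is "?A \<longleftrightarrow> ?B") for r
  proof
    assume ?A
    then obtain x where "L \<subseteq> (\<lambda>k. x + r *\<^sub>R k) ` uminus ` K" ..
    then have "uminus ` L \<subseteq> (\<lambda>k. - x + r *\<^sub>R k) ` K" by force
    then show ?B ..
  next
    assume ?B
    then obtain x where x: "uminus ` L \<subseteq> (\<lambda>k. x + r *\<^sub>R k) ` K" ..
    have "L \<subseteq> (\<lambda>k. - x + r *\<^sub>R k) ` uminus ` K"
    proof
      fix y assume "y \<in> L"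
      with x obtain k where "k \<in> K" "- y = x + r *\<^sub>R k" by blast
      then show "y \<in> (\<lambda>k. - x + r *\<^sub>R k) ` uminus ` K"
        unfolding image_image by (intro image_eqI[of _ _ k]) (auto simp: minus_equation_iff[of y])
    qed
    then show ?A ..
  qed
  then show ?thesis by (simp add: circum_scale_def)
qed

text \<open>
  The vertices of a regular simplex with centroid \<open>0\<close>, described by what is independent of the
  chosen isometry: their Gram matrix, and the fact that they span the space in the strong form of
  a tight frame expansion.
\<close>

locale simplex_vertices =
  fixes w :: "'i::finite \<Rightarrow> 'a::real_inner"
  assumes gram: "w i \<bullet> w j = (if i = j then 1 else 0) - 1 / real CARD('i)"
    and frame: "x = (\<Sum>i\<in>UNIV. (w i \<bullet> x) *\<^sub>R w i)"
begin

abbreviation vertex_hull :: "'a set" where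
  "vertex_hull \<equiv> convex hull (range w)"

lemma sum_vertices: "(\<Sum>i\<in>UNIV. w i) = 0"
proof -
  have "(\<Sum>i\<in>UNIV. w i) \<bullet> w j = 0" for j
    by (simp add: inner_sum_left gram sum_subtractf)
  then have "(\<Sum>i\<in>UNIV. w i) \<bullet> (\<Sum>j\<in>UNIV. w j) = 0"
    by (simp add: inner_sum_right)
  then show ?thesis by simp
qed

lemma sum_vertices_inner: "(\<Sum>i\<in>UNIV. w i \<bullet> x) = 0"
  by (simp add: sum_vertices flip: inner_sum_left)

text \<open>
  Shifting the coefficients of the frame expansion of \<open>x\<close> by \<open>1 / CARD('i)\<close> leaves the point
  unchanged and makes them sum to \<open>1\<close>: they are the barycentric coordinates of \<open>x\<close>, and the facet
  inequalities say that they are nonnegative.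
\<close>

lemma mem_simplex_iff: "x \<in> vertex_hull \<longleftrightarrow> (\<forall>i. - 1 / real CARD('i) \<le> w i \<bullet> x)"
proof
  assume x: "x \<in> vertex_hull"
  have "vertex_hull \<subseteq> {y. - 1 / real CARD('i) \<le> w i \<bullet> y}" for i
    using convex_halfspace_ge[of "- 1 / real CARD('i)" "w i"]
    by (intro hull_minimal) (auto simp: gram)
  with x show "\<forall>i. - 1 / real CARD('i) \<le> w i \<bullet> x" by blast
next
  assume x: "\<forall>i. - 1 / real CARD('i) \<le> w i \<bullet> x"
  have "(\<Sum>i\<in>UNIV. (w i \<bullet> x + 1 / real CARD('i)) *\<^sub>R w i) \<in> vertex_hull"
  proof (rule convex_sum)
    show "(\<Sum>i\<in>UNIV. w i \<bullet> x + 1 / real CARD('i)) = 1"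
      by (simp add: sum.distrib sum_vertices_inner)
    show "0 \<le> w i \<bullet> x + 1 / real CARD('i)" for i
      using x[rule_format, of i] by simp
  qed (auto intro: hull_inc)
  also have "(\<Sum>i\<in>UNIV. (w i \<bullet> x + 1 / real CARD('i)) *\<^sub>R w i) = x"
    using frame[of x] by (simp add: scaleR_add_left sum.distrib sum_vertices flip: scaleR_sum_right)
  finally show "x \<in> vertex_hull" .
qed

text \<open>
  Adding up the facet inequalities of the circumscribed simplex eliminates its centre and gives
  the necessary condition.  It suffices because the numbers \<open>w i \<bullet> x\<close> realise every family with
  sum zero.
\<close>

lemma circumscribed_iff:
  assumes L: "bounded L" "L \<noteq> {}"
  shows "(0 \<le> r \<and> (\<exists>x. L \<subseteq> (\<lambda>k. x + r *\<^sub>R k) ` vertex_hull)) \<longleftrightarrow>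
    (\<Sum>i\<in>UNIV. support_fun L (- w i)) \<le> r"
    (is "?lhs \<longleftrightarrow> ?f \<le> r")
proof
  assume ?lhs
  then obtain x where r: "0 \<le> r" and x: "L \<subseteq> (\<lambda>k. x + r *\<^sub>R k) ` vertex_hull" by blast
  have "support_fun L (- w i) \<le> - (w i \<bullet> x) + r / real CARD('i)" for i
  proof (rule support_fun_least[OF L(2)])
    fix y assume "y \<in> L"
    with x obtain k where "k \<in> vertex_hull" and y: "y = x + r *\<^sub>R k" by blast
    then have "- 1 / real CARD('i) \<le> w i \<bullet> k" by (simp add: mem_simplex_iff)
    then have "r * (- 1 / real CARD('i)) \<le> r * (w i \<bullet> k)" using r by (rule mult_left_mono)
    then show "- w i \<bullet> y \<le> - (w i \<bullet> x) + r / real CARD('i)"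
      by (simp add: y inner_add_right)
  qed
  then have "?f \<le> (\<Sum>i\<in>UNIV. - (w i \<bullet> x) + r / real CARD('i))" by (rule sum_mono)
  also have "\<dots> = r" by (simp add: sum_subtractf sum_vertices_inner)
  finally show "?f \<le> r" .
next
  assume fr: "?f \<le> r"
  \<comment> \<open>The centre \<open>x\<close> of the smallest circumscribed simplex, the one touching \<open>L\<close> along
    every facet, has \<open>w i \<bullet> x = c i\<close>.\<close>
  define c where "c i = ?f / real CARD('i) - support_fun L (- w i)" for i
  define x where "x = (\<Sum>i\<in>UNIV. c i *\<^sub>R w i)"
  have "(\<Sum>i\<in>UNIV. c i) = 0" by (simp add: c_def sum_subtractf)
  then have wx: "w i \<bullet> x = c i" for i
    by (simp add: x_def inner_sum_right gram right_diff_distrib sum_subtractf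
        mult_delta_right flip: sum_divide_distrib)
  have low: "- r / real CARD('i) \<le> w i \<bullet> (y - x)" if "y \<in> L" for i y
  proof -
    have "- w i \<bullet> y \<le> support_fun L (- w i)" using L(1) that by (rule support_fun_upper)
    moreover have "?f / real CARD('i) \<le> r / real CARD('i)" using fr by (simp add: divide_right_mono)
    ultimately show ?thesis by (simp add: inner_diff_right wx c_def)
  qed
  obtain p where p: "p \<in> L" using L by blast
  have "(\<Sum>i\<in>(UNIV::'i set). - r / real CARD('i)) \<le> (\<Sum>i\<in>UNIV. w i \<bullet> (p - x))"
    by (intro sum_mono low p)
  then have r: "0 \<le> r" by (simp add: sum_vertices_inner)
  have "y \<in> (\<lambda>k. x + r *\<^sub>R k) ` vertex_hull" if y: "y \<in> L" for y
  \<comment> \<open>For \<open>r = 0\<close> the difference \<open>y - x\<close> cannot be rescaled into the simplex; instead the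
    facet inequalities force \<open>y = x\<close>.\<close>
  proof (cases "r = 0")
    case True
    then have "0 \<le> w i \<bullet> (y - x)" for i using low[OF y, of i] by simp
    then have "w i \<bullet> (y - x) = 0" for i
      using sum_vertices_inner[of "y - x"] by (simp add: sum_nonneg_eq_0_iff)
    then have "y - x = 0" using frame[of "y - x"] by simp
    then show ?thesis using True by (auto intro: image_eqI[of _ _ "w undefined"] hull_inc)
  next
    case False
    then have "- 1 / real CARD('i) \<le> w i \<bullet> ((1 / r) *\<^sub>R (y - x))" for i
      using mult_left_mono[OF low[OF y, of i], of "1 / r"] r by simp
    then have "(1 / r) *\<^sub>R (y - x) \<in> vertex_hull" by (simp add: mem_simplex_iff)
    with False show ?thesis by (intro image_eqI[of _ _ "(1 / r) *\<^sub>R (y - x)"]) auto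
  qed
  with r show ?lhs by blast
qed

lemma circum_scale_simplex:
  assumes "bounded L" "L \<noteq> {}"
  shows "circum_scale vertex_hull L = (\<Sum>i\<in>UNIV. support_fun L (- w i))"
  unfolding circum_scale_def circumscribed_iff[OF assms]
  by (simp flip: atLeast_def)

lemma rho_simplex:
  assumes L: "bounded L" "L \<noteq> {}" "\<nexists>x. L = {x}"
  shows "rho vertex_hull L =
    (\<Sum>i\<in>UNIV. support_fun L (w i)) / (\<Sum>i\<in>UNIV. support_fun L (- w i))"
  using L
  by (simp add: rho_def circum_scale_uminus circum_scale_simplex support_fun_uminus_image
      bounded_uminus)

lemma rho_depth_class_le:
  assumes P: "P \<in> depth_class d"
  shows "rho vertex_hull P \<le> 2 ^ d - 1"
proof (cases "\<exists>x. P = {x}")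
  case True
  then show ?thesis by (simp add: rho_def)
next
  case False
  let ?f = "\<Sum>i\<in>UNIV. support_fun P (- w i)"
  have Pb: "bounded P" "P \<noteq> {}" using depth_class_bounded_nonempty[OF P] by auto
  have "(\<Sum>i\<in>UNIV. support_fun P (- (- w i))) \<le> (2 ^ d - 1) * ?f"
    by (rule depth_class_sum_support_le[OF P]) (simp add: sum_negf sum_vertices)
  moreover have "0 \<le> ?f"
    using circumscribed_iff[OF Pb, of ?f] by simp
  ultimately show ?thesis
    using False Pb by (auto simp: rho_simplex divide_le_eq)
qed

section \<open>Faces with a power of two many vertices\<close>

text \<open>
  Every direction \<open>- w i\<close> attains its maximum over the whole simplex on the face, since some vertex
  of the face differs from \<open>w i\<close>.  In the opposite directions \<open>w i\<close>, each vertex of the face raises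
  the support value by \<open>1\<close>, starting from a family of values with sum \<open>-1\<close>.
\<close>

lemma rho_face:
  assumes S: "2 \<le> card S"
  shows "rho vertex_hull (convex hull (w ` S)) = real (card S) - 1"
proof -
  let ?T = "convex hull (w ` S)"
  have ne: "S \<noteq> {}" using S by auto
  have T: "bounded ?T" "?T \<noteq> {}"
    using ne by (simp_all add: bounded_convex_hull finite_imp_bounded)
  have other: "\<exists>j\<in>S. j \<noteq> i" for i
  proof (rule ccontr)
    assume "\<not> (\<exists>j\<in>S. j \<noteq> i)"
    then have "S \<subseteq> {i}" by blast
    then have "card S \<le> card {i}" by (intro card_mono) auto
    with S show False by simp
  qed
  have wT: "w j \<in> ?T" if "j \<in> S" for j using that by (auto intro: hull_inc)
  have not_point: "\<nexists>x. ?T = {x}"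
  proof
    assume "\<exists>x. ?T = {x}"
    then obtain x where x: "?T = {x}" ..
    obtain i where i: "i \<in> S" using ne by blast
    obtain j where j: "j \<in> S" "j \<noteq> i" using other by blast
    have "w i = w j" using wT[OF i] wT[OF j(1)] x by simp
    then have "w i \<bullet> w i = w i \<bullet> w j" by simp
    with j show False by (simp add: gram)
  qed
  have neg: "support_fun ?T (- w i) = 1 / real CARD('i)" for i
  proof (rule antisym)
    show "support_fun ?T (- w i) \<le> 1 / real CARD('i)"
      using ne by (intro support_fun_convex_hull_least) (auto simp: gram split: if_splits)
    obtain j where "j \<in> S" "j \<noteq> i" using other by blast
    with support_fun_upper[OF T(1) wT, of j "- w i"]
    show "1 / real CARD('i) \<le> support_fun ?T (- w i)" by (simp add: gram)
  qed
  have pos: "support_fun ?T (w i) = (if i \<in> S then 1 else 0) - 1 / real CARD('i)" for i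
  proof (rule antisym)
    show "support_fun ?T (w i) \<le> (if i \<in> S then 1 else 0) - 1 / real CARD('i)"
      using ne by (intro support_fun_convex_hull_least) (auto simp: gram split: if_splits)
    obtain j where "j \<in> S" "i \<in> S \<longrightarrow> j = i" using ne by blast
    with support_fun_upper[OF T(1) wT, of j "w i"]
    show "(if i \<in> S then 1 else 0) - 1 / real CARD('i) \<le> support_fun ?T (w i)"
      by (auto simp: gram split: if_splits)
  qed
  show ?thesis
    unfolding rho_simplex[OF T not_point] neg pos by (simp add: sum_subtractf flip: sum.inter_filter)
qed

end

lemma convex_hull_power_two_depth_class:
  fixes v :: "'i \<Rightarrow> 'a::real_vector"
  assumes "card S = 2 ^ d"
  shows "convex hull (v ` S) \<in> depth_class d"
  using assms
proof (induction d arbitrary: S)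
  case 0
  then obtain i where "S = {i}" by (auto simp: card_1_singleton_iff)
  then show ?case by simp
next
  case (Suc d)
  obtain A where A: "A \<subseteq> S" "card A = 2 ^ d" "finite A"
    using obtain_subset_with_card_n[of "2 ^ d" S] Suc.prems by auto
  have "card (S - A) = 2 ^ d" using A Suc.prems by (simp add: card_Diff_subset)
  with A Suc.IH have mem: "convex hull (v ` A) \<in> depth_class d"
    "convex hull (v ` (S - A)) \<in> depth_class d" by blast+
  have "v ` S = v ` A \<union> v ` (S - A)" using A(1) by blast
  then have "convex hull (v ` S) =
      (\<Sum>j=1..1::nat. convex hull (convex hull (v ` A) \<union> convex hull (v ` (S - A))))"
    by (simp flip: hull_Un_left hull_Un_right)
  with mem show ?case
    unfolding depth_class.simps mem_Collect_eq
    by (intro exI[of _ "1::nat"] exI[of _ "\<lambda>_. convex hull (v ` A)"]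
        exI[of _ "\<lambda>_. convex hull (v ` (S - A))"]) simp
qed

section \<open>The regular simplex\<close>

lemma linear_proj_ones: "linear (proj_ones :: real^'m \<Rightarrow> real^'m)"
  by (rule linearI) (simp_all add: proj_ones_def inner_add_left add_divide_distrib algebra_simps)

text \<open>
  Norms on the hyperplane determine inner products by polarisation.
\<close>

lemma hyperplane_isometry_inner:
  assumes "hyperplane_isometry \<phi>" "x \<in> ones_hyperplane" "y \<in> ones_hyperplane"
  shows "\<phi> x \<bullet> \<phi> y = x \<bullet> y"
proof -
  have lin: "linear \<phi>" and nrm: "\<And>z. z \<in> ones_hyperplane \<Longrightarrow> norm (\<phi> z) = norm z"
    using assms(1) by (auto simp: hyperplane_isometry_def)
  have "x + y \<in> ones_hyperplane" using assms by (simp add: ones_hyperplane_def inner_add_left)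
  then show ?thesis
    using nrm assms(2,3) by (simp add: dot_norm flip: linear_add[OF lin])
qed

text \<open>
  In the hyperplane, the projected unit vectors inherit the tight frame expansion from the
  coordinate expansion of the ambient space, and \<open>\<phi>\<close> transports it.
\<close>

lemma simplex_vertices_isometry:
  fixes \<phi> :: "real^('n::finite option) \<Rightarrow> real^'n"
  assumes \<phi>: "hyperplane_isometry \<phi>"
  shows "simplex_vertices (\<lambda>i. \<phi> (proj_ones (axis i 1)))"
proof
  let ?N = "real CARD('n option)"
  have lin: "linear \<phi>" using \<phi> by (simp add: hyperplane_isometry_def)
  have one: "(1::real^'n option) \<bullet> 1 = ?N" by (simp add: inner_vec_def)
  have ax: "axis i (1::real) \<bullet> (1::real^'n option) = 1" for i
    by (simp add: inner_axis')
  have pj: "proj_ones (axis i 1) = axis i 1 - (1 / ?N) *\<^sub>R (1::real^'n option)" for i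
    by (simp add: proj_ones_def one ax)
  have H: "proj_ones (axis i 1) \<in> (ones_hyperplane :: (real^'n option) set)" for i
    by (simp add: ones_hyperplane_def pj inner_diff_left ax one)
  show gram: "\<phi> (proj_ones (axis i 1)) \<bullet> \<phi> (proj_ones (axis j 1))
      = (if i = j then 1 else 0) - 1 / ?N" for i j
    unfolding hyperplane_isometry_inner[OF \<phi> H H]
    by (simp add: pj inner_diff_left inner_diff_right ax one inner_axis_axis
        inner_commute[of 1 "axis j 1"])
  fix x :: "real^'n"
  obtain y where y: "y \<in> ones_hyperplane" "x = \<phi> y"
    using \<phi> unfolding hyperplane_isometry_def by (metis UNIV_I imageE)
  have y0: "y \<bullet> 1 = 0" using y by (simp add: ones_hyperplane_def)
  have "y = proj_ones y" using y0 by (simp add: proj_ones_def)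
  also have "\<dots> = proj_ones (\<Sum>i\<in>UNIV. (y $ i) *\<^sub>R axis i 1)"
    by (simp add: basis_expansion flip: scalar_mult_eq_scaleR)
  also have "\<dots> = (\<Sum>i\<in>UNIV. (y $ i) *\<^sub>R proj_ones (axis i 1))"
    by (simp add: linear_sum[OF linear_proj_ones] linear_scale[OF linear_proj_ones])
  finally have "\<phi> y = (\<Sum>i\<in>UNIV. (y $ i) *\<^sub>R \<phi> (proj_ones (axis i 1)))"
    by (metis (no_types, lifting) lin linear_scale linear_sum sum.cong)
  moreover have "\<phi> (proj_ones (axis i 1)) \<bullet> x = y $ i" for i
    unfolding y(2) hyperplane_isometry_inner[OF \<phi> H y(1)]
    by (simp add: pj inner_diff_left inner_commute[of 1 y] y0 inner_axis')
  ultimately show "x = (\<Sum>i\<in>UNIV. (\<phi> (proj_ones (axis i 1)) \<bullet> x) *\<^sub>R \<phi> (proj_ones (axis i 1)))"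
    using y(2) by simp
qed

lemma regular_simplex_eq_hull:
  fixes \<phi> :: "real^('n::finite option) \<Rightarrow> real^'n"
  assumes "hyperplane_isometry \<phi>"
  shows "regular_simplex \<phi> = convex hull (range (\<lambda>i. \<phi> (proj_ones (axis i 1))))"
  using assms
  by (simp add: regular_simplex_def hyperplane_isometry_def convex_hull_linear_image
      linear_proj_ones image_image)

theorem theorem7:
  fixes \<phi> :: "real^('n::finite option) \<Rightarrow> real^'n" and d :: nat
  assumes "hyperplane_isometry \<phi>"
    and "int d < \<lceil>log 2 (real CARD('n) + 1)\<rceil>"
  shows "(\<forall>P :: (real^'n) set. polytope P \<and> has_depth_complexity P d
            \<longrightarrow> rho (regular_simplex \<phi>) P \<le> 2 ^ d - 1) \<and>
         (\<exists>P :: (real^'n) set. polytope P \<and> has_depth_complexity P d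
            \<and> rho (regular_simplex \<phi>) P = 2 ^ d - 1)"
proof -
  define w where "w i = \<phi> (proj_ones (axis i 1))" for i
  interpret simplex_vertices w
    unfolding w_def by (rule simplex_vertices_isometry[OF assms(1)])
  have D: "regular_simplex \<phi> = vertex_hull"
    unfolding w_def by (rule regular_simplex_eq_hull[OF assms(1)])
  have "real d < log 2 (real CARD('n) + 1)"
    using assms(2) by (simp add: less_ceiling_iff)
  then have "2 powr real d < real CARD('n) + 1"
    by (simp add: less_log_iff)
  then have "real (2 ^ d) < real (CARD('n) + 1)"
    by (simp add: powr_realpow)
  then have "2 ^ d \<le> card (UNIV :: 'n option set)"
    by (simp only: of_nat_less_iff card_UNIV_option) simp
  then obtain S :: "'n option set" where S: "card S = 2 ^ d"
    by (meson obtain_subset_with_card_n)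
  let ?P = "convex hull (w ` S)"
  have P: "?P \<in> depth_class d" using S by (rule convex_hull_power_two_depth_class)
  have rho: "rho vertex_hull ?P = 2 ^ d - 1"
  proof (cases d)
    case 0
    then obtain i where "S = {i}" using S by (auto simp: card_1_singleton_iff)
    then show ?thesis using 0 by (simp add: rho_def)
  next
    case (Suc e)
    then have "2 \<le> card S" using S by simp
    from rho_face[OF this] show ?thesis using S by simp
  qed
  \<comment> \<open>A smaller depth would contradict the upper bound for that depth.\<close>
  have "?P \<notin> depth_class e" if "e < d" for e
  proof
    assume "?P \<in> depth_class e"
    from rho_depth_class_le[OF this] rho have "(2::real) ^ d \<le> 2 ^ e" by simp
    with that show False by simp
  qed
  with P have "has_depth_complexity ?P d" by (simp add: has_depth_complexity_def)
  moreover have "polytope ?P" unfolding polytope_def by (intro exI[of _ "w ` S"]) simp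
  ultimately show ?thesis
    using rho rho_depth_class_le unfolding D has_depth_complexity_def by blast
qed

end
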